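(* Let $n\ge 3$, and let $F$ be the free product of $n(n-1)$ copies of $\mathbb{Z}_2$ with generators $a_{pq}$ (each of order two), indexed by ordered pairs $pq$ of distinct elements $p,q\in\{1,\dots,n\}$. For pairwise distinct $i,j,k\in\{1,\dots,n\}$ let $g(a'_{ijk})$ be the map of $F$ to itself defined on generators by $$a_{ij}\mapsto a_{ik}a_{ij}a_{ik},\qquad a_{kj}\mapsto a_{ki}a_{kj}a_{ki},\qquad a_m\mapsto a_m\ \text{ for every ordered pair } m\ne ij,\,kj .$$ Then $g$ is a well-defined homomorphism from ${}'G_n^3$ to the automorphism group $\mathrm{Aut}(F)$.
   Context: Let $n\ge 3$. The group ${}'G_n^3$ is given by a presentation with $3\binom{n}{3}$ generators $a'_{ijk}$ indexed by ordered triples of pairwise distinct numbers $i,j,k\in\{1,\dots,n\}$ up to reversal of the order, i.e. $a'_{ijk}=a'_{kji}$ (so $a'_{123}=a'_{321}\ne a'_{132}$), and relations: (1) $(a'_{ijk})^2=1$ for all pairwise distinct $i,j,k$; (2) $a'_{ijk}a'_{pqr}=a'_{pqr}a'_{ijk}$ for all triples of pairwise distinct numbers $i,j,k$ and $p,q,r$ with $|\{i,j,k\}\cap\{p,q,r\}|<2$; (3) $(a'_{ijk}a'_{ijl}a'_{ikl}a'_{jkl})^2=1$ for every quadruple of pairwise distinct $i,j,k,l\in\{1,\dots,n\}$. *)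

theory Defs
  imports "HOL-Algebra.Bij" "HOL-Algebra.Elementary_Groups"
begin

text \<open>
  The library has neither free products nor groups given by generators and relations.
  Both are built here as quotients of the monoid of words over an alphabet \<open>A\<close> by the
  congruence generated by a set \<open>T\<close> of pairs of words.
\<close>

inductive_set word_cong :: "'l set \<Rightarrow> ('l list \<times> 'l list) set \<Rightarrow> ('l list \<times> 'l list) set"
  for A :: "'l set" and T :: "('l list \<times> 'l list) set"
where
  step: "\<lbrakk>(l, r) \<in> T; l \<in> lists A; r \<in> lists A; u \<in> lists A; v \<in> lists A\<rbrakk>
    \<Longrightarrow> (u @ l @ v, u @ r @ v) \<in> word_cong A T"
| refl: "w \<in> lists A \<Longrightarrow> (w, w) \<in> word_cong A T"
| sym: "(x, y) \<in> word_cong A T \<Longrightarrow> (y, x) \<in> word_cong A T"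
| trans: "\<lbrakk>(x, y) \<in> word_cong A T; (y, z) \<in> word_cong A T\<rbrakk> \<Longrightarrow> (x, z) \<in> word_cong A T"

definition word_class :: "'l set \<Rightarrow> ('l list \<times> 'l list) set \<Rightarrow> 'l list \<Rightarrow> 'l list set"
  where "word_class A T w = word_cong A T `` {w}"

definition word_quotient :: "'l set \<Rightarrow> ('l list \<times> 'l list) set \<Rightarrow> 'l list set monoid"
  where "word_quotient A T =
    \<lparr>carrier = lists A // word_cong A T,
     monoid.mult = (\<lambda>X Y. {w. \<exists>x\<in>X. \<exists>y\<in>Y. (x @ y, w) \<in> word_cong A T}),
     one = word_class A T []\<rparr>"

text \<open>
  The letter \<open>(i, x)\<close> stands for the element \<open>x\<close> of the factor \<open>G i\<close>; identity letters may be
  deleted and adjacent letters from the same factor may be multiplied.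
\<close>

definition free_product_letters :: "'i set \<Rightarrow> ('i \<Rightarrow> 'a monoid) \<Rightarrow> ('i \<times> 'a) set"
  where "free_product_letters I G = (SIGMA i:I. carrier (G i))"

definition free_product_rels ::
    "'i set \<Rightarrow> ('i \<Rightarrow> 'a monoid) \<Rightarrow> (('i \<times> 'a) list \<times> ('i \<times> 'a) list) set"
  where "free_product_rels I G =
    {([(i, \<one>\<^bsub>G i\<^esub>)], []) | i. i \<in> I} \<union>
    {([(i, x), (i, y)], [(i, x \<otimes>\<^bsub>G i\<^esub> y)]) | i x y.
       i \<in> I \<and> x \<in> carrier (G i) \<and> y \<in> carrier (G i)}"

definition free_product :: "'i set \<Rightarrow> ('i \<Rightarrow> 'a monoid) \<Rightarrow> ('i \<times> 'a) list set monoid"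
  where "free_product I G = word_quotient (free_product_letters I G) (free_product_rels I G)"

definition free_product_incl ::
    "'i set \<Rightarrow> ('i \<Rightarrow> 'a monoid) \<Rightarrow> 'i \<Rightarrow> 'a \<Rightarrow> ('i \<times> 'a) list set"
  where "free_product_incl I G i x =
    word_class (free_product_letters I G) (free_product_rels I G) [(i, x)]"

text \<open>
  In a presentation the letter \<open>(s, True)\<close> is the generator \<open>s\<close> and \<open>(s, False)\<close> its formal inverse.
\<close>

definition presentation_rels ::
    "'s set \<Rightarrow> (('s \<times> bool) list \<times> ('s \<times> bool) list) set
      \<Rightarrow> (('s \<times> bool) list \<times> ('s \<times> bool) list) set"
  where "presentation_rels S R = {([(s, b), (s, \<not> b)], []) | s b. s \<in> S} \<union> R"

definition presented_group ::
    "'s set \<Rightarrow> (('s \<times> bool) list \<times> ('s \<times> bool) list) set \<Rightarrow> ('s \<times> bool) list set monoid"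
  where "presented_group S R = word_quotient (S \<times> UNIV) (presentation_rels S R)"

definition presented_gen ::
    "'s set \<Rightarrow> (('s \<times> bool) list \<times> ('s \<times> bool) list) set \<Rightarrow> 's \<Rightarrow> ('s \<times> bool) list set"
  where "presented_gen S R s = word_class (S \<times> UNIV) (presentation_rels S R) [(s, True)]"

text \<open>A generator of \<open>'G_n^3\<close> is an ordered triple up to reversal, i.e. a reversal class of triples.\<close>

definition triple_class :: "nat \<Rightarrow> nat \<Rightarrow> nat \<Rightarrow> (nat \<times> nat \<times> nat) set"
  where "triple_class i j k = {(i, j, k), (k, j, i)}"

definition G3_gens :: "nat \<Rightarrow> (nat \<times> nat \<times> nat) set set"
  where "G3_gens n = {triple_class i j k | i j k. {i, j, k} \<subseteq> {1..n} \<and> distinct [i, j, k]}"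

abbreviation G3_letter :: "nat \<Rightarrow> nat \<Rightarrow> nat \<Rightarrow> (nat \<times> nat \<times> nat) set \<times> bool"
  where "G3_letter i j k \<equiv> (triple_class i j k, True)"

definition G3_rels ::
    "nat \<Rightarrow> (((nat \<times> nat \<times> nat) set \<times> bool) list \<times> ((nat \<times> nat \<times> nat) set \<times> bool) list) set"
  where "G3_rels n =
    {([G3_letter i j k, G3_letter i j k], []) | i j k.
       {i, j, k} \<subseteq> {1..n} \<and> distinct [i, j, k]} \<union>
    {([G3_letter i j k, G3_letter p q r], [G3_letter p q r, G3_letter i j k]) | i j k p q r.
       {i, j, k} \<subseteq> {1..n} \<and> distinct [i, j, k] \<and>
       {p, q, r} \<subseteq> {1..n} \<and> distinct [p, q, r] \<and>
       card ({i, j, k} \<inter> {p, q, r}) < 2} \<union>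
    {([G3_letter i j k, G3_letter i j l, G3_letter i k l, G3_letter j k l,
       G3_letter i j k, G3_letter i j l, G3_letter i k l, G3_letter j k l], []) | i j k l.
       {i, j, k, l} \<subseteq> {1..n} \<and> distinct [i, j, k, l]}"

definition G3 :: "nat \<Rightarrow> ((nat \<times> nat \<times> nat) set \<times> bool) list set monoid"
  where "G3 n = presented_group (G3_gens n) (G3_rels n)"

definition G3_gen :: "nat \<Rightarrow> nat \<Rightarrow> nat \<Rightarrow> nat \<Rightarrow> ((nat \<times> nat \<times> nat) set \<times> bool) list set"
  where "G3_gen n i j k = presented_gen (G3_gens n) (G3_rels n) (triple_class i j k)"

definition ordered_pairs :: "nat \<Rightarrow> (nat \<times> nat) set"
  where "ordered_pairs n = {(p, q). p \<in> {1..n} \<and> q \<in> {1..n} \<and> p \<noteq> q}"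

definition F :: "nat \<Rightarrow> ((nat \<times> nat) \<times> int) list set monoid"
  where "F n = free_product (ordered_pairs n) (\<lambda>_. integer_mod_group 2)"

definition F_gen :: "nat \<Rightarrow> nat \<times> nat \<Rightarrow> ((nat \<times> nat) \<times> int) list set"
  where "F_gen n m = free_product_incl (ordered_pairs n) (\<lambda>_. integer_mod_group 2) m 1"

definition acts_as_g ::
    "nat \<Rightarrow> nat \<Rightarrow> nat \<Rightarrow> nat
      \<Rightarrow> (((nat \<times> nat) \<times> int) list set \<Rightarrow> ((nat \<times> nat) \<times> int) list set) \<Rightarrow> bool"
  where "acts_as_g n i j k \<phi> \<longleftrightarrow>
    \<phi> (F_gen n (i, j)) = F_gen n (i, k) \<otimes>\<^bsub>F n\<^esub> F_gen n (i, j) \<otimes>\<^bsub>F n\<^esub> F_gen n (i, k) \<and>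
    \<phi> (F_gen n (k, j)) = F_gen n (k, i) \<otimes>\<^bsub>F n\<^esub> F_gen n (k, j) \<otimes>\<^bsub>F n\<^esub> F_gen n (k, i) \<and>
    (\<forall>m \<in> ordered_pairs n - {(i, j), (k, j)}. \<phi> (F_gen n m) = F_gen n m)"

text \<open>The constructions above do yield groups.\<close>

lemma word_cong_lists: "(x, y) \<in> word_cong A T \<Longrightarrow> x \<in> lists A \<and> y \<in> lists A"
  by (induction rule: word_cong.induct) auto

lemma equiv_word_cong: "equiv (lists A) (word_cong A T)"
proof (rule equivI)
  show "word_cong A T \<subseteq> lists A \<times> lists A"
    by (auto dest: word_cong_lists)
  show "refl_on (lists A) (word_cong A T)"
    by (auto simp: refl_on_def intro: word_cong.refl)
  show "sym (word_cong A T)"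
    by (auto intro: symI word_cong.sym)
  show "trans (word_cong A T)"
    by (rule transI) (rule word_cong.trans)
qed

lemma word_cong_context:
  assumes "(x, y) \<in> word_cong A T" "u \<in> lists A" "v \<in> lists A"
  shows "(u @ x @ v, u @ y @ v) \<in> word_cong A T"
  using assms
proof (induction rule: word_cong.induct)
  case (step l r u' v')
  then show ?case
    using word_cong.step[of l r T A "u @ u'" "v' @ v"] by simp
next
  case (refl w)
  then show ?case by (intro word_cong.refl) simp
next
  case (sym x y)
  then show ?case by (blast intro: word_cong.sym)
next
  case (trans x y z)
  then show ?case by (blast intro: word_cong.trans)
qed

lemma word_cong_append:
  assumes "(x, x') \<in> word_cong A T" "(y, y') \<in> word_cong A T"
  shows "(x @ y, x' @ y') \<in> word_cong A T"
proof -
  have "(x @ y, x' @ y) \<in> word_cong A T"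
    using word_cong_context[OF assms(1), of "[]" y] word_cong_lists[OF assms(2)] by simp
  moreover have "(x' @ y, x' @ y') \<in> word_cong A T"
    using word_cong_context[OF assms(2), of x' "[]"] word_cong_lists[OF assms(1)] by simp
  ultimately show ?thesis by (rule word_cong.trans)
qed

lemma word_class_eq_iff:
  "x \<in> lists A \<Longrightarrow> y \<in> lists A
    \<Longrightarrow> word_class A T x = word_class A T y \<longleftrightarrow> (x, y) \<in> word_cong A T"
  unfolding word_class_def by (rule eq_equiv_class_iff[OF equiv_word_cong])

lemma carrier_word_quotient: "carrier (word_quotient A T) = word_class A T ` lists A"
  by (auto simp: word_quotient_def quotient_def word_class_def)

lemma one_word_quotient: "\<one>\<^bsub>word_quotient A T\<^esub> = word_class A T []"
  by (simp add: word_quotient_def)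

lemma mult_word_quotient:
  assumes "x \<in> lists A" "y \<in> lists A"
  shows "word_class A T x \<otimes>\<^bsub>word_quotient A T\<^esub> word_class A T y = word_class A T (x @ y)"
  using assms
  by (auto simp: word_quotient_def word_class_def
      intro: word_cong.trans word_cong_append word_cong.refl)

lemma group_word_quotient:
  assumes inv: "\<And>a. a \<in> A \<Longrightarrow> \<exists>b\<in>A. ([b, a], []) \<in> word_cong A T"
  shows "group (word_quotient A T)"
proof (rule groupI)
  fix X Y Z
  assume "X \<in> carrier (word_quotient A T)" "Y \<in> carrier (word_quotient A T)"
    "Z \<in> carrier (word_quotient A T)"
  then obtain x y z where "x \<in> lists A" "y \<in> lists A" "z \<in> lists A"
    "X = word_class A T x" "Y = word_class A T y" "Z = word_class A T z"
    unfolding carrier_word_quotient by blast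
  then show "X \<otimes>\<^bsub>word_quotient A T\<^esub> Y \<otimes>\<^bsub>word_quotient A T\<^esub> Z
    = X \<otimes>\<^bsub>word_quotient A T\<^esub> (Y \<otimes>\<^bsub>word_quotient A T\<^esub> Z)"
    by (simp add: mult_word_quotient)
next
  have ex: "\<exists>v\<in>lists A. (v @ w, []) \<in> word_cong A T" if "w \<in> lists A" for w
    using that
  proof (induction w)
    case Nil
    then show ?case by (auto intro: word_cong.refl)
  next
    case (Cons a w)
    then obtain v b where v: "v \<in> lists A" "(v @ w, []) \<in> word_cong A T"
      and b: "b \<in> A" "([b, a], []) \<in> word_cong A T"
      using inv by (metis Cons_in_lists_iff)
    have "(v @ [b, a] @ w, v @ [] @ w) \<in> word_cong A T"
      by (rule word_cong_context[OF b(2)]) (use v word_cong_lists[OF v(2)] in simp_all)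
    then have "((v @ [b]) @ a # w, []) \<in> word_cong A T"
      using v(2) by (auto intro: word_cong.trans)
    moreover have "v @ [b] \<in> lists A"
      using v b by simp
    ultimately show ?case by blast
  qed
  fix X
  assume "X \<in> carrier (word_quotient A T)"
  then obtain w where w: "w \<in> lists A" "X = word_class A T w"
    by (auto simp: carrier_word_quotient)
  obtain v where v: "v \<in> lists A" "(v @ w, []) \<in> word_cong A T"
    using ex w by blast
  have "word_class A T v \<otimes>\<^bsub>word_quotient A T\<^esub> X = \<one>\<^bsub>word_quotient A T\<^esub>"
    using v w by (simp add: mult_word_quotient one_word_quotient word_class_eq_iff)
  moreover have "word_class A T v \<in> carrier (word_quotient A T)"
    using v by (simp add: carrier_word_quotient)
  ultimately show "\<exists>Y\<in>carrier (word_quotient A T).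
      Y \<otimes>\<^bsub>word_quotient A T\<^esub> X = \<one>\<^bsub>word_quotient A T\<^esub>"
    by blast
next
  fix X Y
  assume "X \<in> carrier (word_quotient A T)" "Y \<in> carrier (word_quotient A T)"
  then obtain x y where "x \<in> lists A" "y \<in> lists A"
    "X = word_class A T x" "Y = word_class A T y"
    unfolding carrier_word_quotient by blast
  then show "X \<otimes>\<^bsub>word_quotient A T\<^esub> Y \<in> carrier (word_quotient A T)"
    by (simp add: mult_word_quotient carrier_word_quotient)
next
  show "\<one>\<^bsub>word_quotient A T\<^esub> \<in> carrier (word_quotient A T)"
    by (simp add: one_word_quotient carrier_word_quotient)
next
  fix X
  assume "X \<in> carrier (word_quotient A T)"
  then obtain x where "x \<in> lists A" "X = word_class A T x"
    unfolding carrier_word_quotient by blast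
  then show "\<one>\<^bsub>word_quotient A T\<^esub> \<otimes>\<^bsub>word_quotient A T\<^esub> X = X"
    by (simp add: one_word_quotient mult_word_quotient)
qed

lemma group_free_product:
  assumes "\<And>i. i \<in> I \<Longrightarrow> group (G i)"
  shows "group (free_product I G)"
  unfolding free_product_def
proof (rule group_word_quotient)
  let ?A = "free_product_letters I G" and ?T = "free_product_rels I G"
  fix a assume "a \<in> ?A"
  then obtain i x where a: "a = (i, x)" "i \<in> I" "x \<in> carrier (G i)"
    by (auto simp: free_product_letters_def)
  interpret group "G i" using assms a by blast
  let ?b = "(i, inv\<^bsub>G i\<^esub> x)"
  have b: "?b \<in> ?A" and o: "(i, \<one>\<^bsub>G i\<^esub>) \<in> ?A" and aA: "a \<in> ?A"
    using a by (auto simp: free_product_letters_def)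
  have "([?b, a], [(i, inv\<^bsub>G i\<^esub> x \<otimes>\<^bsub>G i\<^esub> x)]) \<in> ?T"
    unfolding free_product_rels_def using a inv_closed by blast
  then have "([?b, a], [(i, \<one>\<^bsub>G i\<^esub>)]) \<in> ?T"
    using a by simp
  then have "([?b, a], [(i, \<one>\<^bsub>G i\<^esub>)]) \<in> word_cong ?A ?T"
    using word_cong.step[of _ _ ?T ?A "[]" "[]"] b o aA by simp
  moreover have "([(i, \<one>\<^bsub>G i\<^esub>)], []) \<in> ?T"
    using a by (auto simp: free_product_rels_def)
  then have "([(i, \<one>\<^bsub>G i\<^esub>)], []) \<in> word_cong ?A ?T"
    using word_cong.step[of _ "[]" ?T ?A "[]" "[]"] o by simp
  ultimately show "\<exists>b\<in>?A. ([b, a], []) \<in> word_cong ?A ?T"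
    using b by (blast intro: word_cong.trans)
qed

lemma group_presented_group: "group (presented_group S R)"
  unfolding presented_group_def
proof (rule group_word_quotient)
  fix a :: "'a \<times> bool" assume "a \<in> S \<times> UNIV"
  then obtain s c where a: "a = (s, c)" "s \<in> S" by auto
  have "([(s, \<not> c), (s, \<not> \<not> c)], []) \<in> presentation_rels S R"
    unfolding presentation_rels_def using a by blast
  then have "([(s, \<not> c), a], []) \<in> word_cong (S \<times> UNIV) (presentation_rels S R)"
    using word_cong.step[of _ "[]" "presentation_rels S R" "S \<times> UNIV" "[]" "[]"] a by simp
  then show "\<exists>b\<in>S \<times> UNIV. ([b, a], []) \<in> word_cong (S \<times> UNIV) (presentation_rels S R)"
    using a by blast
qed

lemma group_G3: "group (G3 n)"
  unfolding G3_def by (rule group_presented_group)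

lemma group_F: "group (F n)"
  unfolding F_def by (rule group_free_product) simp

end

theory Submission
  imports Defs
begin

text \<open>
  Write \<open>\<tau> i j k\<close> for the endomorphism of \<open>F\<close> that conjugates \<open>a\<^sub>i\<^sub>j\<close> by \<open>a\<^sub>i\<^sub>k\<close> and \<open>a\<^sub>k\<^sub>j\<close> by \<open>a\<^sub>k\<^sub>i\<close>
  (the constant \<open>twist\<close>). It exists because a conjugate of an involution is an involution, which is all that the free
  product of groups of order two demands of the image of a generator (\<open>F_universal\<close>). The
  description is symmetric in \<open>i\<close> and \<open>k\<close>, so \<open>\<tau> i j k\<close> depends only on the reversal class of
  the triple. Since a homomorphism on a presented group amounts to images of the generators that
  satisfy the relations (\<open>presented_group_universal\<close>), it remains to see that the \<open>\<tau> i j k\<close> are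
  invertible and satisfy the three families of relations, and this may be tested on the
  generators of \<open>F\<close>.

  The conjugating letters \<open>a\<^sub>i\<^sub>k\<close> and \<open>a\<^sub>k\<^sub>i\<close> are fixed by \<open>\<tau> i j k\<close>, so applying the map twice conjugates
  twice by the same involution: \<open>\<tau> i j k\<close> is its own inverse, hence an automorphism
  (\<open>twist_auto\<close>), and the relation that squares a generator holds.

  Every letter that \<open>\<tau> i j k\<close> moves or conjugates by has both indices in \<open>{i, j, k}\<close>. Two triples
  with at most one common index share no ordered pair of distinct indices, so their maps
  commute (\<open>twist_commute_gen\<close>).

  For the relation of four indices, observe that each map preserves the first index: \<open>a\<^sub>p\<^sub>q\<close> goes to
  a word in letters \<open>a\<^sub>p\<^sub>r\<close>. The relation therefore splits into one check per first index, in a free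
  product of three groups of order two. For first index \<open>i\<close>, with \<open>x = a\<^sub>i\<^sub>j\<close>, \<open>y = a\<^sub>i\<^sub>k\<close>, \<open>z = a\<^sub>i\<^sub>l\<close>,
  the composite \<open>\<tau> i j k \<circ> \<tau> i j l \<circ> \<tau> i k l \<circ> \<tau> j k l\<close> sends \<open>x\<close> to \<open>z y x y z\<close>, \<open>y\<close> to \<open>z y z\<close> and \<open>z\<close> to
  itself. Applied again to \<open>z y x y z\<close> it gives \<open>z (z y z) (z y x y z) (z y z) z\<close>, which cancels to
  \<open>x\<close>, and in the same way \<open>y\<close> returns to \<open>y\<close>. The other first indices are alike or
  simpler (\<open>twist_tetrahedron_gen\<close>).
\<close>

section \<open>Universal properties of quotients of word monoids\<close>

definition word_eval :: "('b, 'c) monoid_scheme \<Rightarrow> ('l \<Rightarrow> 'b) \<Rightarrow> 'l list \<Rightarrow> 'b"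
  where "word_eval H f w = foldr (\<lambda>a x. f a \<otimes>\<^bsub>H\<^esub> x) w \<one>\<^bsub>H\<^esub>"

lemma word_eval_Nil [simp]: "word_eval H f [] = \<one>\<^bsub>H\<^esub>"
  and word_eval_Cons [simp]: "word_eval H f (a # w) = f a \<otimes>\<^bsub>H\<^esub> word_eval H f w"
  by (simp_all add: word_eval_def)

context monoid
begin

lemma word_eval_closed:
  "f \<in> A \<rightarrow> carrier G \<Longrightarrow> w \<in> lists A \<Longrightarrow> word_eval G f w \<in> carrier G"
  by (induction w) auto

lemma word_eval_append:
  assumes f: "f \<in> A \<rightarrow> carrier G" and w: "v \<in> lists A" "w \<in> lists A"
  shows "word_eval G f (v @ w) = word_eval G f v \<otimes> word_eval G f w"
  using w(1)
proof (induction v)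
  case Nil
  then show ?case using word_eval_closed[OF f w(2)] by simp
next
  case (Cons a v)
  then show ?case
    using word_eval_closed[OF f w(2)] word_eval_closed[OF f, of v] f
    by (auto simp: m_assoc Pi_iff)
qed

text \<open>
  Evaluation is multiplicative, so a substitution inside a word changes the value only through the
  two sides of the rule. This is why evaluation descends to the quotient.
\<close>

lemma word_eval_cong:
  assumes f: "f \<in> A \<rightarrow> carrier G"
    and T: "\<And>l r. \<lbrakk>(l, r) \<in> T; l \<in> lists A; r \<in> lists A\<rbrakk> \<Longrightarrow> word_eval G f l = word_eval G f r"
    and vw: "(v, w) \<in> word_cong A T"
  shows "word_eval G f v = word_eval G f w"
  using vw by induction (simp_all add: word_eval_append[OF f] T)

end

lemma word_class_closed: "w \<in> lists A \<Longrightarrow> word_class A T w \<in> carrier (word_quotient A T)"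
  by (simp add: carrier_word_quotient)

lemma word_quotient_hom_eqI:
  assumes Q: "group (word_quotient A T)" and H: "group H"
    and h: "h \<in> hom (word_quotient A T) H" "h' \<in> hom (word_quotient A T) H"
    and eq: "\<And>a. a \<in> A \<Longrightarrow> h (word_class A T [a]) = h' (word_class A T [a])"
    and X: "X \<in> carrier (word_quotient A T)"
  shows "h X = h' X"
proof -
  have "h (word_class A T w) = h' (word_class A T w)" if "w \<in> lists A" for w
    using that
  proof (induction w)
    case Nil
    then show ?case
      using hom_one[OF h(1) Q H] hom_one[OF h(2) Q H] by (simp add: one_word_quotient)
  next
    case (Cons a w)
    have "word_class A T (a # w) = word_class A T [a] \<otimes>\<^bsub>word_quotient A T\<^esub> word_class A T w"
      using Cons by (simp add: mult_word_quotient)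
    then show ?case
      using Cons h by (simp add: hom_mult word_class_closed eq)
  qed
  then show ?thesis
    using X by (auto simp: carrier_word_quotient)
qed

text \<open>
  Extensionality makes the homomorphism unique as a HOL function, whose values outside the carrier
  would otherwise be arbitrary.
\<close>

theorem word_quotient_universal:
  assumes Q: "group (word_quotient A T)" and H: "group H"
    and f: "f \<in> A \<rightarrow> carrier H"
    and T: "\<And>l r. \<lbrakk>(l, r) \<in> T; l \<in> lists A; r \<in> lists A\<rbrakk> \<Longrightarrow> word_eval H f l = word_eval H f r"
  shows "\<exists>!h. h \<in> hom (word_quotient A T) H \<inter> extensional (carrier (word_quotient A T)) \<and>
    (\<forall>a\<in>A. h (word_class A T [a]) = f a)"
proof -
  interpret H: group H by fact
  define h where "h = (\<lambda>X\<in>carrier (word_quotient A T). word_eval H f (SOME w. w \<in> X))"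
  have h: "h (word_class A T w) = word_eval H f w" if w: "w \<in> lists A" for w
  proof -
    have "w \<in> word_class A T w"
      using w by (auto simp: word_class_def intro: word_cong.refl)
    then have "(SOME v. v \<in> word_class A T w) \<in> word_class A T w"
      by (rule someI)
    then have "(w, SOME v. v \<in> word_class A T w) \<in> word_cong A T"
      by (simp add: word_class_def)
    then show ?thesis
      using H.word_eval_cong[OF f T] w by (simp add: h_def word_class_closed)
  qed
  have "h \<in> hom (word_quotient A T) H"
    unfolding hom_def carrier_word_quotient
    by (simp add: Pi_iff h mult_word_quotient H.word_eval_append[OF f] H.word_eval_closed[OF f])
  moreover have "h (word_class A T [a]) = f a" if "a \<in> A" for a
    using that f by (auto simp: h Pi_iff)
  moreover have "h \<in> extensional (carrier (word_quotient A T))"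
    by (simp add: h_def)
  moreover have "k = k'"
    if "k \<in> hom (word_quotient A T) H" "k' \<in> hom (word_quotient A T) H"
      and "k \<in> extensional (carrier (word_quotient A T))"
        "k' \<in> extensional (carrier (word_quotient A T))"
      and "\<forall>a\<in>A. k (word_class A T [a]) = f a" "\<forall>a\<in>A. k' (word_class A T [a]) = f a"
    for k k'
    using that(3,4) by (rule extensionalityI) (simp add: word_quotient_hom_eqI[OF Q H that(1,2)] that)
  ultimately show ?thesis
    by (intro ex1I[of _ h]) blast+
qed

lemma free_product_incl_closed:
  "i \<in> I \<Longrightarrow> x \<in> carrier (G i) \<Longrightarrow> free_product_incl I G i x \<in> carrier (free_product I G)"
  by (simp add: free_product_def free_product_incl_def word_class_closed free_product_letters_def)

lemma free_product_relI:
  assumes "(l, r) \<in> free_product_rels I G"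
    "l \<in> lists (free_product_letters I G)" "r \<in> lists (free_product_letters I G)"
  shows "word_class (free_product_letters I G) (free_product_rels I G) l
    = word_class (free_product_letters I G) (free_product_rels I G) r"
  using word_cong.step[OF assms, of "[]" "[]"] assms by (simp add: word_class_eq_iff)

lemma free_product_incl_hom:
  assumes "i \<in> I" and G: "\<And>i. i \<in> I \<Longrightarrow> group (G i)"
  shows "free_product_incl I G i \<in> hom (G i) (free_product I G)"
proof (rule homI)
  interpret group "G i" using assms by blast
  fix x y assume xy: "x \<in> carrier (G i)" "y \<in> carrier (G i)"
  have "([(i, x), (i, y)], [(i, x \<otimes>\<^bsub>G i\<^esub> y)]) \<in> free_product_rels I G"
    using assms(1) xy by (auto simp: free_product_rels_def)
  from free_product_relI[OF this]
  show "free_product_incl I G i (x \<otimes>\<^bsub>G i\<^esub> y)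
      = free_product_incl I G i x \<otimes>\<^bsub>free_product I G\<^esub> free_product_incl I G i y"
    using assms(1) xy
    by (simp add: free_product_def free_product_incl_def mult_word_quotient
        free_product_letters_def)
qed (simp add: assms free_product_incl_closed)

theorem free_product_universal:
  assumes G: "\<And>i. i \<in> I \<Longrightarrow> group (G i)" and H: "group H"
    and f: "\<And>i. i \<in> I \<Longrightarrow> f i \<in> hom (G i) H"
  shows "\<exists>!h. h \<in> hom (free_product I G) H \<inter> extensional (carrier (free_product I G)) \<and>
    (\<forall>i\<in>I. \<forall>x\<in>carrier (G i). h (free_product_incl I G i x) = f i x)"
proof -
  interpret H: group H by fact
  let ?A = "free_product_letters I G" and ?T = "free_product_rels I G"
  have "word_eval H (case_prod f) l = word_eval H (case_prod f) r" if "(l, r) \<in> ?T" for l r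
    using that f H hom_one[OF f G H] hom_in_carrier[OF f]
    by (auto simp: free_product_rels_def hom_mult[OF f] group.is_monoid[OF G] monoid.m_closed)
  moreover have "case_prod f \<in> ?A \<rightarrow> carrier H"
    using hom_in_carrier[OF f] by (auto simp: free_product_letters_def)
  ultimately have "\<exists>!h. h \<in> hom (free_product I G) H \<inter> extensional (carrier (free_product I G)) \<and>
    (\<forall>a\<in>?A. h (word_class ?A ?T [a]) = case_prod f a)"
    using group_free_product[OF G] H unfolding free_product_def
    by (intro word_quotient_universal)
  moreover have "(\<forall>a\<in>?A. h (word_class ?A ?T [a]) = case_prod f a)
      \<longleftrightarrow> (\<forall>i\<in>I. \<forall>x\<in>carrier (G i). h (free_product_incl I G i x) = f i x)" for h
    by (auto simp: free_product_letters_def free_product_incl_def)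
  ultimately show ?thesis by simp
qed

text \<open>
  This identity lets images be prescribed for the generators alone: a homomorphism must send a formal
  inverse to the inverse of the image.
\<close>

lemma presented_gen_inverse_class:
  assumes "s \<in> S"
  shows "word_class (S \<times> UNIV) (presentation_rels S R) [(s, False)]
    = inv\<^bsub>presented_group S R\<^esub> presented_gen S R s"
proof (rule group.inv_equality[OF group_presented_group, symmetric])
  let ?A = "S \<times> UNIV" and ?T = "presentation_rels S R"
  have "([(s, False), (s, \<not> False)], []) \<in> ?T"
    using assms unfolding presentation_rels_def by blast
  from word_cong.step[OF this, of ?A "[]" "[]"]
  show "word_class ?A ?T [(s, False)] \<otimes>\<^bsub>presented_group S R\<^esub> presented_gen S R s
      = \<one>\<^bsub>presented_group S R\<^esub>"
    using assms
    by (simp add: presented_group_def presented_gen_def mult_word_quotient one_word_quotient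
        word_class_eq_iff)
qed (use assms in \<open>auto simp: presented_group_def presented_gen_def word_class_closed\<close>)

theorem presented_group_universal:
  assumes H: "group H" and t: "t \<in> S \<rightarrow> carrier H"
    and R: "\<And>l r. \<lbrakk>(l, r) \<in> R; l \<in> lists (S \<times> UNIV); r \<in> lists (S \<times> UNIV)\<rbrakk>
      \<Longrightarrow> word_eval H (\<lambda>(s, b). if b then t s else inv\<^bsub>H\<^esub> t s) l
        = word_eval H (\<lambda>(s, b). if b then t s else inv\<^bsub>H\<^esub> t s) r"
  shows "\<exists>!h. h \<in> hom (presented_group S R) H \<inter> extensional (carrier (presented_group S R)) \<and>
    (\<forall>s\<in>S. h (presented_gen S R s) = t s)"
proof -
  interpret H: group H by fact
  let ?A = "S \<times> (UNIV :: bool set)" and ?T = "presentation_rels S R"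
  let ?f = "\<lambda>(s, b). if b then t s else inv\<^bsub>H\<^esub> t s"
  have "word_eval H ?f l = word_eval H ?f r"
    if "(l, r) \<in> ?T" "l \<in> lists ?A" "r \<in> lists ?A" for l r
    using that t R[of l r] by (auto simp: presentation_rels_def Pi_iff)
  moreover have "?f \<in> ?A \<rightarrow> carrier H"
    using t by (auto simp: Pi_iff)
  ultimately have "\<exists>!h. h \<in> hom (presented_group S R) H \<inter> extensional (carrier (presented_group S R)) \<and>
    (\<forall>a\<in>?A. h (word_class ?A ?T [a]) = ?f a)"
    using group_presented_group[of S R] H unfolding presented_group_def
    by (intro word_quotient_universal)
  moreover have "(\<forall>a\<in>?A. h (word_class ?A ?T [a]) = ?f a)
      \<longleftrightarrow> (\<forall>s\<in>S. h (presented_gen S R s) = t s)"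
    if h: "h \<in> hom (presented_group S R) H" for h
  proof
    assume *: "\<forall>s\<in>S. h (presented_gen S R s) = t s"
    interpret h: group_hom "presented_group S R" H h
      by (intro group_hom.intro group_presented_group H group_hom_axioms.intro h)
    have "h (word_class ?A ?T [(s, b)]) = ?f (s, b)" if s: "s \<in> S" for s b
    proof (cases b)
      case True
      then show ?thesis using s * by (simp add: presented_gen_def)
    next
      case False
      have "presented_gen S R s \<in> carrier (presented_group S R)"
        using s by (simp add: presented_group_def presented_gen_def word_class_closed)
      then show ?thesis
        using False s * by (simp add: presented_gen_inverse_class h.hom_inv)
    qed
    then show "\<forall>a\<in>?A. h (word_class ?A ?T [a]) = ?f a" by auto
  qed (auto simp: presented_gen_def)
  ultimately show ?thesis by (simp cong: conj_cong)
qed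

section \<open>Words in an automorphism group\<close>

lemma AutoGroup_carrier: "carrier (AutoGroup G) = auto G"
  and AutoGroup_one: "\<one>\<^bsub>AutoGroup G\<^esub> = (\<lambda>x\<in>carrier G. x)"
  by (simp_all add: AutoGroup_def BijGroup_def)

lemma AutoGroup_mult_apply:
  "\<lbrakk>\<phi> \<in> auto G; \<psi> \<in> auto G; x \<in> carrier G\<rbrakk> \<Longrightarrow> (\<phi> \<otimes>\<^bsub>AutoGroup G\<^esub> \<psi>) x = \<phi> (\<psi> x)"
  by (simp add: AutoGroup_def BijGroup_def auto_def compose_eq)

text \<open>
  Applying a product of automorphisms to an element runs through the word from its right end. This
  turns an equation between words in the automorphism group into iterated substitutions that
  rewriting can carry out.
\<close>

lemma AutoGroup_word_eval_apply:
  assumes G: "group G" and f: "f \<in> A \<rightarrow> auto G" and w: "w \<in> lists A" and x: "x \<in> carrier G"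
  shows "word_eval (AutoGroup G) f w x = foldr f w x"
  using w
proof (induction w)
  case Nil
  then show ?case using x by (simp add: AutoGroup_one)
next
  case (Cons a w)
  interpret Aut: group "AutoGroup G" by (rule group.AutoGroup[OF G])
  have "word_eval (AutoGroup G) f w \<in> auto G"
    using Aut.word_eval_closed[of f A w] f Cons by (simp add: AutoGroup_carrier)
  then show ?case
    using Cons f x by (auto simp: AutoGroup_mult_apply Pi_iff)
qed

section \<open>The free product of copies of the group of order two\<close>

text \<open>The only elements of the cyclic group of order two are 0 and 1, so \<open>t\<close> is the image of 1.\<close>

lemma involution_hom:
  assumes "group H" "t \<in> carrier H" "t \<otimes>\<^bsub>H\<^esub> t = \<one>\<^bsub>H\<^esub>"
  shows "(\<lambda>x. if x = 0 then \<one>\<^bsub>H\<^esub> else t) \<in> hom (integer_mod_group 2) H"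
proof -
  interpret group H by fact
  have "carrier (integer_mod_group 2) = {0, 1}"
    by (auto simp: carrier_integer_mod_group)
  then show ?thesis
    using assms by (simp add: hom_def)
qed

lemma F_gen_closed: "m \<in> ordered_pairs n \<Longrightarrow> F_gen n m \<in> carrier (F n)"
  by (simp add: F_def F_gen_def free_product_incl_closed)

lemma F_incl_zero:
  assumes "m \<in> ordered_pairs n"
  shows "free_product_incl (ordered_pairs n) (\<lambda>_. integer_mod_group 2) m 0 = \<one>\<^bsub>F n\<^esub>"
  using hom_one[OF free_product_incl_hom[OF assms, of "\<lambda>_. integer_mod_group 2"]]
    group_F[of n] by (simp add: F_def)

lemma F_gen_square:
  assumes "m \<in> ordered_pairs n"
  shows "F_gen n m \<otimes>\<^bsub>F n\<^esub> F_gen n m = \<one>\<^bsub>F n\<^esub>"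
  using hom_mult[OF free_product_incl_hom[OF assms, of "\<lambda>_. integer_mod_group 2"], of 1 1]
  by (simp add: F_incl_zero[OF assms] flip: F_def F_gen_def)

lemma F_gen_cancel:
  assumes "m \<in> ordered_pairs n" "x \<in> carrier (F n)"
  shows "F_gen n m \<otimes>\<^bsub>F n\<^esub> (F_gen n m \<otimes>\<^bsub>F n\<^esub> x) = x"
proof -
  interpret F: group "F n" by (rule group_F)
  show ?thesis
    using assms by (simp add: F_gen_closed F_gen_square flip: F.m_assoc)
qed

text \<open>
  A homomorphism from a group of order two is determined by the image of the generator, which may be
  any element of square one. The universal property of the free product thus reduces to a choice of
  one such element for each ordered pair.
\<close>

theorem F_universal:
  assumes H: "group H"
    and t: "\<And>m. m \<in> ordered_pairs n \<Longrightarrow> t m \<in> carrier H \<and> t m \<otimes>\<^bsub>H\<^esub> t m = \<one>\<^bsub>H\<^esub>"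
  shows "\<exists>!h. h \<in> hom (F n) H \<inter> extensional (carrier (F n)) \<and>
    (\<forall>m\<in>ordered_pairs n. h (F_gen n m) = t m)"
proof -
  let ?G = "\<lambda>_::nat \<times> nat. integer_mod_group 2"
  have "\<exists>!h. h \<in> hom (F n) H \<inter> extensional (carrier (F n)) \<and>
      (\<forall>m\<in>ordered_pairs n. \<forall>x\<in>carrier (integer_mod_group 2).
        h (free_product_incl (ordered_pairs n) ?G m x) = (if x = 0 then \<one>\<^bsub>H\<^esub> else t m))"
    unfolding F_def
    by (rule free_product_universal) (auto simp: H t intro: involution_hom)
  moreover have "(\<forall>x\<in>carrier (integer_mod_group 2).
      h (free_product_incl (ordered_pairs n) ?G m x) = (if x = 0 then \<one>\<^bsub>H\<^esub> else t m))
      \<longleftrightarrow> h (F_gen n m) = t m"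
    if h: "h \<in> hom (F n) H" and m: "m \<in> ordered_pairs n" for h m
  proof -
    have "carrier (integer_mod_group 2) = {0, 1}"
      by (auto simp: carrier_integer_mod_group)
    then show ?thesis
      using hom_one[OF h group_F H] by (simp add: F_incl_zero[OF m] F_gen_def)
  qed
  ultimately show ?thesis by (simp cong: conj_cong)
qed

text \<open>
  Both homomorphisms solve the extension problem posed by the images \<open>h (F_gen n m)\<close>. Those
  images have square one because the generators do, so the uniqueness in \<open>F_universal\<close> applies.
\<close>

lemma F_hom_eqI:
  assumes H: "group H" and h: "h \<in> hom (F n) H" "h' \<in> hom (F n) H"
    and eq: "\<And>m. m \<in> ordered_pairs n \<Longrightarrow> h (F_gen n m) = h' (F_gen n m)"
    and x: "x \<in> carrier (F n)"
  shows "h x = h' x"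
proof -
  have "h (F_gen n m) \<otimes>\<^bsub>H\<^esub> h (F_gen n m) = \<one>\<^bsub>H\<^esub>" if "m \<in> ordered_pairs n" for m
    using hom_mult[OF h(1), of "F_gen n m" "F_gen n m"] that hom_one[OF h(1) group_F H]
    by (simp add: F_gen_closed F_gen_square)
  then have "\<exists>!k. k \<in> hom (F n) H \<inter> extensional (carrier (F n)) \<and>
      (\<forall>m\<in>ordered_pairs n. k (F_gen n m) = h (F_gen n m))" (is "\<exists>!k. ?P k")
    using h by (intro F_universal[OF H]) (auto simp: F_gen_closed intro: hom_in_carrier)
  moreover have "restrict k (carrier (F n)) \<in> hom (F n) H" if "k \<in> hom (F n) H" for k
    using that group.is_monoid[OF group_F[of n]] by (simp add: hom_def Pi_iff monoid.m_closed)
  then have "?P (restrict h (carrier (F n)))" "?P (restrict h' (carrier (F n)))"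
    using h by (simp_all add: eq F_gen_closed)
  ultimately have "restrict h (carrier (F n)) = restrict h' (carrier (F n))"
    by blast
  then show ?thesis
    using x by (metis restrict_apply')
qed

section \<open>The automorphisms attached to triples\<close>

definition twist_image :: "nat \<Rightarrow> nat \<Rightarrow> nat \<Rightarrow> nat \<Rightarrow> nat \<times> nat \<Rightarrow> ((nat \<times> nat) \<times> int) list set"
  where "twist_image n i j k m =
    (if m = (i, j) then F_gen n (i, k) \<otimes>\<^bsub>F n\<^esub> F_gen n (i, j) \<otimes>\<^bsub>F n\<^esub> F_gen n (i, k)
     else if m = (k, j) then F_gen n (k, i) \<otimes>\<^bsub>F n\<^esub> F_gen n (k, j) \<otimes>\<^bsub>F n\<^esub> F_gen n (k, i)
     else F_gen n m)"

definition twist ::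
    "nat \<Rightarrow> nat \<Rightarrow> nat \<Rightarrow> nat \<Rightarrow> ((nat \<times> nat) \<times> int) list set \<Rightarrow> ((nat \<times> nat) \<times> int) list set"
  where "twist n i j k =
    (THE \<phi>. \<phi> \<in> hom (F n) (F n) \<inter> extensional (carrier (F n)) \<and> acts_as_g n i j k \<phi>)"

text \<open>
  The defining conditions for \<open>(i, j)\<close> and \<open>(k, j)\<close> are exchanged by the reversal. The map is
  therefore an invariant of the reversal class, as a generator of \<open>G3 n\<close> demands.
\<close>

lemma acts_as_g_reverse: "acts_as_g n k j i \<phi> \<longleftrightarrow> acts_as_g n i j k \<phi>"
proof -
  have "{(k, j), (i, j)} = {(i, j), (k, j)}" by blast
  then show ?thesis unfolding acts_as_g_def by (simp only:) blast
qed

lemma twist_reverse: "twist n k j i = twist n i j k"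
  by (simp add: twist_def acts_as_g_reverse)

lemma ordered_pairs_iff:
  "(p, q) \<in> ordered_pairs n \<longleftrightarrow> p \<in> {1..n} \<and> q \<in> {1..n} \<and> p \<noteq> q"
  by (simp add: ordered_pairs_def)

lemma ordered_pairs_of_triple:
  assumes "{i, j, k} \<subseteq> {1..n}" "distinct [i, j, k]"
  shows "(i, j) \<in> ordered_pairs n" "(i, k) \<in> ordered_pairs n"
    "(k, j) \<in> ordered_pairs n" "(k, i) \<in> ordered_pairs n"
  using assms by (auto simp: ordered_pairs_iff)

lemma twist_ex1:
  assumes "{i, j, k} \<subseteq> {1..n}" "distinct [i, j, k]"
  shows "\<exists>!\<phi>. \<phi> \<in> hom (F n) (F n) \<inter> extensional (carrier (F n)) \<and> acts_as_g n i j k \<phi>"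
proof -
  interpret F: group "F n" by (rule group_F)
  note pairs = ordered_pairs_of_triple[OF assms]
  have "acts_as_g n i j k \<phi> \<longleftrightarrow> (\<forall>m\<in>ordered_pairs n. \<phi> (F_gen n m) = twist_image n i j k m)" for \<phi>
    using pairs assms(2) by (auto simp: acts_as_g_def twist_image_def)
  moreover have "\<exists>!\<phi>. \<phi> \<in> hom (F n) (F n) \<inter> extensional (carrier (F n)) \<and>
      (\<forall>m\<in>ordered_pairs n. \<phi> (F_gen n m) = twist_image n i j k m)"
    by (rule F_universal[OF group_F])
      (use pairs in \<open>simp add: twist_image_def F_gen_closed F_gen_square
        F_gen_cancel F.m_assoc\<close>)
  ultimately show ?thesis by simp
qed

lemma twist_spec:
  assumes "{i, j, k} \<subseteq> {1..n}" "distinct [i, j, k]"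
  shows "twist n i j k \<in> hom (F n) (F n)" "twist n i j k \<in> extensional (carrier (F n))"
    "acts_as_g n i j k (twist n i j k)"
  using theI'[OF twist_ex1[OF assms]] by (auto simp: twist_def)

text \<open>
  The conjugates are bracketed to the right, the normal form of \<open>m_assoc\<close>, so that together with
  \<open>twist_mult\<close>, \<open>F_gen_square\<close> and \<open>F_gen_cancel\<close> these equations bring the words that arise in \<open>F n\<close> to reduced form.
\<close>

lemma twist_gen:
  assumes "{i, j, k} \<subseteq> {1..n}" "distinct [i, j, k]"
  shows "twist n i j k (F_gen n (i, j))
      = F_gen n (i, k) \<otimes>\<^bsub>F n\<^esub> (F_gen n (i, j) \<otimes>\<^bsub>F n\<^esub> F_gen n (i, k))"
    and "twist n i j k (F_gen n (k, j))
      = F_gen n (k, i) \<otimes>\<^bsub>F n\<^esub> (F_gen n (k, j) \<otimes>\<^bsub>F n\<^esub> F_gen n (k, i))"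
    and "\<lbrakk>m \<in> ordered_pairs n; m \<noteq> (i, j); m \<noteq> (k, j)\<rbrakk>
      \<Longrightarrow> twist n i j k (F_gen n m) = F_gen n m"
proof -
  interpret F: group "F n" by (rule group_F)
  show "twist n i j k (F_gen n (i, j))
      = F_gen n (i, k) \<otimes>\<^bsub>F n\<^esub> (F_gen n (i, j) \<otimes>\<^bsub>F n\<^esub> F_gen n (i, k))"
    and "twist n i j k (F_gen n (k, j))
      = F_gen n (k, i) \<otimes>\<^bsub>F n\<^esub> (F_gen n (k, j) \<otimes>\<^bsub>F n\<^esub> F_gen n (k, i))"
    using twist_spec(3)[OF assms] ordered_pairs_of_triple[OF assms]
    by (simp_all add: acts_as_g_def F.m_assoc F_gen_closed)
  show "\<lbrakk>m \<in> ordered_pairs n; m \<noteq> (i, j); m \<noteq> (k, j)\<rbrakk>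
      \<Longrightarrow> twist n i j k (F_gen n m) = F_gen n m"
    using twist_spec(3)[OF assms] by (simp add: acts_as_g_def)
qed

lemma twist_mult:
  assumes "{i, j, k} \<subseteq> {1..n}" "distinct [i, j, k]" "x \<in> carrier (F n)" "y \<in> carrier (F n)"
  shows "twist n i j k (x \<otimes>\<^bsub>F n\<^esub> y) = twist n i j k x \<otimes>\<^bsub>F n\<^esub> twist n i j k y"
  using hom_mult[OF twist_spec(1)[OF assms(1,2)] assms(3,4)] .

text \<open>
  The conjugating letters \<open>(i, k)\<close> and \<open>(k, i)\<close> are fixed, so the second application conjugates once
  more by the same involution and undoes the first.
\<close>

lemma twist_twist_gen:
  assumes "{i, j, k} \<subseteq> {1..n}" "distinct [i, j, k]" "m \<in> ordered_pairs n"
  shows "twist n i j k (twist n i j k (F_gen n m)) = F_gen n m"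
proof -
  interpret F: group "F n" by (rule group_F)
  show ?thesis
    using ordered_pairs_of_triple[OF assms(1,2)] assms(2,3)
    by (cases "m = (i, j) \<or> m = (k, j)")
      (auto simp: twist_gen[OF assms(1,2)] twist_mult[OF assms(1,2)] F_gen_closed F_gen_square
        F_gen_cancel F.m_assoc)
qed

lemma twist_involution:
  assumes "{i, j, k} \<subseteq> {1..n}" "distinct [i, j, k]" "x \<in> carrier (F n)"
  shows "twist n i j k (twist n i j k x) = x"
proof -
  have "(twist n i j k \<circ> twist n i j k) x = id x"
  proof (rule F_hom_eqI[OF group_F _ _ _ assms(3)])
    show "twist n i j k \<circ> twist n i j k \<in> hom (F n) (F n)"
      using twist_spec(1)[OF assms(1,2)] twist_spec(1)[OF assms(1,2)] by (rule hom_compose)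
    show "id \<in> hom (F n) (F n)"
      by (simp add: hom_def)
  qed (simp add: twist_twist_gen[OF assms(1,2)])
  then show ?thesis by simp
qed

lemma twist_auto:
  assumes "{i, j, k} \<subseteq> {1..n}" "distinct [i, j, k]"
  shows "twist n i j k \<in> auto (F n)"
proof -
  have "bij_betw (twist n i j k) (carrier (F n)) (carrier (F n))"
    using twist_involution[OF assms] hom_in_carrier[OF twist_spec(1)[OF assms]]
    by (intro bij_betw_byWitness[where f' = "twist n i j k"]) auto
  then show ?thesis
    using twist_spec[OF assms] by (simp add: auto_def Bij_def)
qed

section \<open>The relations of the group on triples\<close>

text \<open>
  An ordered pair of distinct indices cannot lie in both triples. Each map therefore fixes every
  letter that occurs in the description of the other one.
\<close>

lemma twist_commute_gen:
  assumes ijk: "{i, j, k} \<subseteq> {1..n}" "distinct [i, j, k]"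
    and pqr: "{p, q, r} \<subseteq> {1..n}" "distinct [p, q, r]"
    and one: "card ({i, j, k} \<inter> {p, q, r}) < 2"
    and m: "m \<in> ordered_pairs n"
  shows "twist n i j k (twist n p q r (F_gen n m)) = twist n p q r (twist n i j k (F_gen n m))"
proof -
  have common: "x = y" if "x \<in> {i, j, k} \<inter> {p, q, r}" "y \<in> {i, j, k} \<inter> {p, q, r}" for x y
  proof (rule ccontr)
    assume "x \<noteq> y"
    then have "card {x, y} = 2" by simp
    moreover have "card {x, y} \<le> card ({i, j, k} \<inter> {p, q, r})"
      using that by (intro card_mono) auto
    ultimately show False using one by simp
  qed
  have fix_pqr: "twist n p q r (F_gen n (x, y)) = F_gen n (x, y)"
    if "x \<in> {i, j, k}" "y \<in> {i, j, k}" "x \<noteq> y" for x y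
    using that ijk pqr common[of x y]
    by (intro twist_gen(3)) (auto simp: ordered_pairs_iff)
  have fix_ijk: "twist n i j k (F_gen n (x, y)) = F_gen n (x, y)"
    if "x \<in> {p, q, r}" "y \<in> {p, q, r}" "x \<noteq> y" for x y
    using that ijk pqr common[of x y]
    by (intro twist_gen(3)) (auto simp: ordered_pairs_iff)
  interpret F: group "F n" by (rule group_F)
  note pairs = ordered_pairs_of_triple[OF ijk] ordered_pairs_of_triple[OF pqr]
  consider "m = (i, j) \<or> m = (k, j)" | "m = (p, q) \<or> m = (r, q)"
    | "m \<noteq> (i, j)" "m \<noteq> (k, j)" "m \<noteq> (p, q)" "m \<noteq> (r, q)" by blast
  then show ?thesis
  proof cases
    case 1
    then show ?thesis
      using ijk(2) pairs
      by (auto simp: twist_gen(1,2)[OF ijk] twist_mult[OF pqr] F_gen_closed fix_pqr)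
  next
    case 2
    then show ?thesis
      using pqr(2) pairs
      by (auto simp: twist_gen(1,2)[OF pqr] twist_mult[OF ijk] F_gen_closed fix_ijk)
  next
    case 3
    then show ?thesis
      using m by (simp add: twist_gen(3)[OF ijk] twist_gen(3)[OF pqr])
  qed
qed

text \<open>
  All letters in the images of \<open>a\<^sub>p\<^sub>q\<close> keep the first index \<open>p\<close>, so each case takes place in a free product
  of three groups of order two, where cancelling equal neighbours decides the equation.
\<close>

lemma twist_tetrahedron_gen:
  assumes n: "{i, j, k, l} \<subseteq> {1..n}" and d: "distinct [i, j, k, l]"
    and m: "m \<in> ordered_pairs n"
  defines "\<tau> \<equiv> twist n i j k \<circ> twist n i j l \<circ> twist n i k l \<circ> twist n j k l"
  shows "\<tau> (\<tau> (F_gen n m)) = F_gen n m"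
proof -
  interpret F: group "F n" by (rule group_F)
  have ijk: "{i, j, k} \<subseteq> {1..n}" "distinct [i, j, k]"
    and ijl: "{i, j, l} \<subseteq> {1..n}" "distinct [i, j, l]"
    and ikl: "{i, k, l} \<subseteq> {1..n}" "distinct [i, k, l]"
    and jkl: "{j, k, l} \<subseteq> {1..n}" "distinct [j, k, l]"
    using n d by auto
  have pairs: "(x, y) \<in> ordered_pairs n" if "x \<in> {i, j, k, l}" "y \<in> {i, j, k, l}" "x \<noteq> y" for x y
    using that n by (auto simp: ordered_pairs_iff)
  have ne: "i \<noteq> j" "i \<noteq> k" "i \<noteq> l" "j \<noteq> k" "j \<noteq> l" "k \<noteq> l"
    "j \<noteq> i" "k \<noteq> i" "l \<noteq> i" "k \<noteq> j" "l \<noteq> j" "l \<noteq> k"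
    using d by auto
  note gen = twist_gen[OF ijk] twist_gen[OF ijl] twist_gen[OF ikl] twist_gen[OF jkl]
  note mult = twist_mult[OF ijk] twist_mult[OF ijl] twist_mult[OF ikl] twist_mult[OF jkl]
  note rules = \<tau>_def gen mult pairs ne F_gen_closed F_gen_square F_gen_cancel F.m_assoc
  \<comment> \<open>Only the generators moved by one of the four maps need a computation.\<close>
  consider "m = (i, j)" | "m = (i, k)" | "m = (j, k)" | "m = (k, j)" | "m = (l, j)" | "m = (l, k)"
    | "m \<notin> {(i, j), (i, k), (j, k), (k, j), (l, j), (l, k)}" by blast
  then show ?thesis
  proof cases
    case 7
    then show ?thesis using m by (simp add: \<tau>_def gen)
  qed (simp_all add: rules)
qed

text \<open>
  A representative of the reversal class is picked arbitrarily; by \<open>twist_reverse\<close> the choice does not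
  matter.
\<close>

definition triple_twist ::
    "nat \<Rightarrow> (nat \<times> nat \<times> nat) set \<Rightarrow> ((nat \<times> nat) \<times> int) list set \<Rightarrow> ((nat \<times> nat) \<times> int) list set"
  where "triple_twist n s = (case SOME p. p \<in> s of (i, j, k) \<Rightarrow> twist n i j k)"

lemma triple_twist_class: "triple_twist n (triple_class i j k) = twist n i j k"
proof -
  have "(SOME p. p \<in> triple_class i j k) \<in> triple_class i j k"
    by (rule someI[of _ "(i, j, k)"]) (simp add: triple_class_def)
  then show ?thesis
    using twist_reverse[of n i j k] by (auto simp: triple_twist_def triple_class_def)
qed

lemma ball_G3_gens_iff:
  "(\<forall>s\<in>G3_gens n. P s) \<longleftrightarrow>
    (\<forall>i j k. {i, j, k} \<subseteq> {1..n} \<and> distinct [i, j, k] \<longrightarrow> P (triple_class i j k))"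
  unfolding G3_gens_def by blast

text \<open>
  The relations contain no formal inverses, so only the values of \<open>f\<close> on the letters \<open>(s, True)\<close> are
  prescribed. Both sides evaluate to automorphisms of \<open>F n\<close>, which agree as soon as they agree on
  the generators.
\<close>

lemma G3_rels_hold:
  assumes lr: "(l, r) \<in> G3_rels n" "l \<in> lists (G3_gens n \<times> UNIV)" "r \<in> lists (G3_gens n \<times> UNIV)"
    and t: "f \<in> G3_gens n \<times> UNIV \<rightarrow> auto (F n)"
    and f: "\<And>s. f (s, True) = triple_twist n s"
  shows "word_eval (AutoGroup (F n)) f l = word_eval (AutoGroup (F n)) f r"
proof -
  interpret Aut: group "AutoGroup (F n)" by (rule group.AutoGroup[OF group_F])
  have auto: "word_eval (AutoGroup (F n)) f w \<in> auto (F n)" if "w \<in> lists (G3_gens n \<times> UNIV)" for w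
    using Aut.word_eval_closed[of f "G3_gens n \<times> UNIV" w] t that by (simp add: AutoGroup_carrier)
  have gen: "foldr f l (F_gen n m) = foldr f r (F_gen n m)" if "m \<in> ordered_pairs n" for m
    using lr(1) unfolding G3_rels_def Un_iff mem_Collect_eq
  proof (elim disjE exE conjE)
    fix i j k
    assume "(l, r) = ([G3_letter i j k, G3_letter i j k], [])"
      "{i, j, k} \<subseteq> {1..n}" "distinct [i, j, k]"
    then show ?thesis
      using twist_twist_gen[of i j k n m] that by (simp add: f triple_twist_class)
  next
    fix i j k p q r'
    assume "(l, r) = ([G3_letter i j k, G3_letter p q r'], [G3_letter p q r', G3_letter i j k])"
      "{i, j, k} \<subseteq> {1..n}" "distinct [i, j, k]" "{p, q, r'} \<subseteq> {1..n}" "distinct [p, q, r']"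
      "card ({i, j, k} \<inter> {p, q, r'}) < 2"
    then show ?thesis
      using twist_commute_gen[of i j k n p q r' m] that by (simp add: f triple_twist_class)
  next
    fix i j k l'
    assume "(l, r) = ([G3_letter i j k, G3_letter i j l', G3_letter i k l', G3_letter j k l',
        G3_letter i j k, G3_letter i j l', G3_letter i k l', G3_letter j k l'], [])"
      "{i, j, k, l'} \<subseteq> {1..n}" "distinct [i, j, k, l']"
    then show ?thesis
      using twist_tetrahedron_gen[of i j k l' n m] that by (simp add: f triple_twist_class)
  qed
  have agree: "word_eval (AutoGroup (F n)) f l x = word_eval (AutoGroup (F n)) f r x"
    if "x \<in> carrier (F n)" for x
  proof (rule F_hom_eqI[OF group_F _ _ _ that])
    show "word_eval (AutoGroup (F n)) f l \<in> hom (F n) (F n)"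
      and "word_eval (AutoGroup (F n)) f r \<in> hom (F n) (F n)"
      using auto lr(2,3) unfolding auto_def by blast+
  qed (simp add: gen AutoGroup_word_eval_apply[OF group_F t lr(2)]
      AutoGroup_word_eval_apply[OF group_F t lr(3)] F_gen_closed)
  have "word_eval (AutoGroup (F n)) f l \<in> extensional (carrier (F n))"
    and "word_eval (AutoGroup (F n)) f r \<in> extensional (carrier (F n))"
    using auto[OF lr(2)] auto[OF lr(3)] by (simp_all add: auto_def Bij_def)
  then show ?thesis
    by (rule extensionalityI) (rule agree)
qed

theorem theorem2:
  fixes n :: nat
  assumes "n \<ge> 3"
  shows "(\<forall>i j k. {i, j, k} \<subseteq> {1..n} \<and> distinct [i, j, k] \<longrightarrow>
            (\<exists>!\<phi>. \<phi> \<in> hom (F n) (F n) \<inter> extensional (carrier (F n)) \<and> acts_as_g n i j k \<phi>))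
       \<and> (\<exists>!g. g \<in> hom (G3 n) (AutoGroup (F n)) \<inter> extensional (carrier (G3 n)) \<and>
            (\<forall>i j k. {i, j, k} \<subseteq> {1..n} \<and> distinct [i, j, k] \<longrightarrow>
              acts_as_g n i j k (g (G3_gen n i j k))))"
proof
  show "\<forall>i j k. {i, j, k} \<subseteq> {1..n} \<and> distinct [i, j, k] \<longrightarrow>
      (\<exists>!\<phi>. \<phi> \<in> hom (F n) (F n) \<inter> extensional (carrier (F n)) \<and> acts_as_g n i j k \<phi>)"
    by (intro allI impI, elim conjE) (rule twist_ex1)
next
  interpret Aut: group "AutoGroup (F n)" by (rule group.AutoGroup[OF group_F])
  let ?S = "G3_gens n"
  have t: "triple_twist n \<in> ?S \<rightarrow> auto (F n)"
    by (auto simp: G3_gens_def triple_twist_class twist_auto)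
  then have inv: "inv\<^bsub>AutoGroup (F n)\<^esub> triple_twist n s \<in> auto (F n)" if "s \<in> ?S" for s
    using that Aut.inv_closed by (auto simp: AutoGroup_carrier)
  have "\<exists>!g. g \<in> hom (G3 n) (AutoGroup (F n)) \<inter> extensional (carrier (G3 n)) \<and>
      (\<forall>s\<in>?S. g (presented_gen ?S (G3_rels n) s) = triple_twist n s)"
    unfolding G3_def
    by (intro presented_group_universal Aut.is_group G3_rels_hold)
      (use t inv in \<open>auto simp: AutoGroup_carrier\<close>)
  moreover have "(\<forall>s\<in>?S. g (presented_gen ?S (G3_rels n) s) = triple_twist n s) \<longleftrightarrow>
      (\<forall>i j k. {i, j, k} \<subseteq> {1..n} \<and> distinct [i, j, k] \<longrightarrow>
        acts_as_g n i j k (g (G3_gen n i j k)))"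
    if g: "g \<in> hom (G3 n) (AutoGroup (F n))" for g
  proof -
    have gen_iff: "acts_as_g n i j k (g (G3_gen n i j k)) \<longleftrightarrow>
        g (presented_gen ?S (G3_rels n) (triple_class i j k)) = triple_twist n (triple_class i j k)"
      if ijk: "{i, j, k} \<subseteq> {1..n}" "distinct [i, j, k]" for i j k
    proof -
      have "triple_class i j k \<in> ?S"
        using ijk by (auto simp: G3_gens_def)
      then have "G3_gen n i j k \<in> carrier (G3 n)"
        by (simp add: G3_gen_def G3_def presented_group_def presented_gen_def word_class_closed)
      \<comment> \<open>An automorphism is in particular an extensional endomorphism, so the uniqueness of the
        twist pins down the value of \<open>g\<close>.\<close>
      then have "g (G3_gen n i j k) \<in> hom (F n) (F n) \<inter> extensional (carrier (F n))"
        using hom_in_carrier[OF g] by (auto simp: AutoGroup_carrier auto_def Bij_def)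
      then have "acts_as_g n i j k (g (G3_gen n i j k)) \<longleftrightarrow> g (G3_gen n i j k) = twist n i j k"
        using twist_ex1[OF ijk] twist_spec[OF ijk] by auto
      then show ?thesis
        using ijk by (simp add: G3_gen_def triple_twist_class)
    qed
    then show ?thesis
      unfolding ball_G3_gens_iff
      by (intro iff_allI imp_cong[OF HOL.refl], elim conjE) (rule gen_iff[symmetric])
  qed
  ultimately show "\<exists>!g. g \<in> hom (G3 n) (AutoGroup (F n)) \<inter> extensional (carrier (G3 n)) \<and>
      (\<forall>i j k. {i, j, k} \<subseteq> {1..n} \<and> distinct [i, j, k] \<longrightarrow>
        acts_as_g n i j k (g (G3_gen n i j k)))"
    by (simp cong: conj_cong)
qed

end
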